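(* Let $\mathcal{N}=(N,m_0,M_f)$ be a bounded labelled stochastic process (LSP), assumed complete, and let $A$ be a DFA over $\mathcal{A}$. Then $$\sum_{\sigma\text{ model trace of }\mathcal{N},\ \sigma\in\mathcal{L}(A)}\mathbb{P}_{\mathcal{N}}(\sigma)\;=\;\sum_{\eta\text{ run of }\Upsilon}\mathbb{P}_{\Upsilon}(\eta),$$ where $\Upsilon=\Upsilon_{\mathcal{N}}^{\bar{A}}$ is the product system of $\mathcal{N}$ and the silenced DFA $\bar{A}$; i.e. the specification probability of $A$ in $\mathcal{N}$ equals the outcome probability of the set of all final states of $\Upsilon$.
   Context: Fix a finite set $\mathcal{A}$ of task names and a silent label $\tau\notin\mathcal{A}$; $\Sigma=\mathcal{A}\cup\{\tau\}$. An LGSPN is $N=(Q,T,F,\ell,w)$ with finite disjoint sets $Q$ (places) and $T$ (transitions), flow relation $F\subseteq(Q\times T)\cup(T\times Q)$, labelling $\ell:T\to\Sigma$, $T$ partitioned into immediate transitions $T^{im}$ and timed transitions $T^{ti}$, and weights $w:T\to\mathbb{R}^{+}$. A marking is a multiset of places; $t$ is enabled in $m$ if its input places ${}^\bullet t\le m$ and either $t\in T^{im}$ or no immediate $t'$ has ${}^\bullet t'\le m$; firing gives $m'=(m-{}^\bullet t)+t^\bullet$. A deadlock marking enables no transition. An LSP is $\mathcal{N}=(N,m_0,M_f)$ with $M_f$ a finite set of deadlock markings; it is complete if $M_f$ equals the set of reachable deadlock markings, and bounded if the number of tokens per place over reachable markings is bounded. The firing probability of $t$ in $m$ is $w(t)/\sum_{t'\text{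 enabled in }m}w(t')$ if $t$ is enabled, else $0$. The (stochastic) reachability graph $RG(\mathcal{N})$ has states the markings reachable from $m_0$, edges $(m,t,m')$ for each firing of $t$ in $m$ yielding $m'$, with probability the firing probability of $t$ in $m$, initial state $m_0$ and final states the reachable markings in $M_f$. A run of $\mathcal{N}$ is a path in $RG(\mathcal{N})$ from $m_0$ to a final state, with probability the product of its edge probabilities; it induces the trace in $\mathcal{A}^*$ obtained from its label sequence by deleting $\tau$'s; a model trace is a trace induced by some run, and $\mathbb{P}_{\mathcal{N}}(\sigma)$ is the sum of the probabilities of the runs inducing $\sigma$. A DFA over $L$ is $(L,S,s_0,S_f,\delta)$ with partial $\delta:S\times L\to S$; $\mathcal{L}(A)$ is the set of accepted words. The silenced DFA $\bar{A}$ of a DFA $A$ over $\mathcal{A}$ is $A$ with a $\tau$-labelled self-loop added at every state. The product system $\Upsilon_{\mathcal{N}}^{B}$ of $\mathcal{N}$ and a DFA $B=(\Sigma,S^2,s_0^2,S_f^2,\delta^2)$ is the (possibly sub-stochastic) transition system whose states are pairs, defined inductively as the least sets with: initial state $(m_0,s_0^2)$; whenever $(s^1,s^2)$ is a state, $(s^1,t,s^{1\prime})$ is an edge of $RG(\mathcal{N})$ and $\delta^2(s^2,\ell(t))=s^{2\prime}$ is defined, then $(s^{1\prime},s^{2\prime})$ is a state, $((s^1,s^2),t,(s^{1\prime},s^{2\prime}))$ is an edge with the same probability as $(s^1,t,s^{1\prime})$, and $(s^{1\prime},s^{2\prime})$ is final if $s^{1\prime}$ is final in $RG(\mathcal{N})$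 and $s^{2\prime}\in S_f^2$. A run of $\Upsilon$ is a path from its initial state to a final state; $\mathbb{P}_{\Upsilon}(\eta)$ is the product of its edge probabilities.
   Formalization: The initial state of the product system also counts as final when its marking is final and its DFA state accepting; with final states only those reached by an edge, the identity fails (1 versus 0) when the initial marking is a deadlock and the empty word is accepted. *)

theory Defs
  imports "HOL-Analysis.Analysis" "HOL-Library.Multiset"
begin

section \<open>Stochastic transition systems\<close>

text \<open>An edge is a triple (source, transition, target); \<open>edge_prob\<close> is only meaningful on edges.\<close>

record ('s, 't) sts =
  states :: "'s set"
  edges :: "('s \<times> 't \<times> 's) set"
  edge_prob :: "'s \<times> 't \<times> 's \<Rightarrow> real"
  init :: 's
  finals :: "'s set"

fun is_path :: "('s, 't) sts \<Rightarrow> 's \<Rightarrow> ('s \<times> 't \<times> 's) list \<Rightarrow> 's \<Rightarrow> bool" where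
  "is_path G s [] s' \<longleftrightarrow> s \<in> states G \<and> s' = s"
| "is_path G s ((u, t, v) # es) s' \<longleftrightarrow> (u, t, v) \<in> edges G \<and> u = s \<and> is_path G v es s'"

definition runs :: "('s, 't) sts \<Rightarrow> ('s \<times> 't \<times> 's) list set" where
  "runs G = {es. \<exists>s\<in>finals G. is_path G (init G) es s}"

definition path_prob :: "('s, 't) sts \<Rightarrow> ('s \<times> 't \<times> 's) list \<Rightarrow> real" where
  "path_prob G es = (\<Prod>e\<leftarrow>es. edge_prob G e)"

section \<open>Labelled generalised stochastic Petri nets\<close>

record ('v, 'a) lgspn =
  places :: "'v set"
  transitions :: "'v set"
  immediate :: "'v set"
  timed :: "'v set"
  flow :: "('v \<times> 'v) set"
  label :: "'v \<Rightarrow> 'a"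
  weight :: "'v \<Rightarrow> real"

definition is_lgspn :: "'a set \<Rightarrow> 'a \<Rightarrow> ('v, 'a) lgspn \<Rightarrow> bool" where
  "is_lgspn Acts tau N \<longleftrightarrow>
     finite (places N) \<and> finite (transitions N) \<and> places N \<inter> transitions N = {} \<and>
     flow N \<subseteq> (places N \<times> transitions N) \<union> (transitions N \<times> places N) \<and>
     (\<forall>t\<in>transitions N. label N t \<in> insert tau Acts) \<and>
     immediate N \<union> timed N = transitions N \<and> immediate N \<inter> timed N = {} \<and>
     (\<forall>t\<in>transitions N. weight N t > 0)"

definition preset :: "('v, 'a) lgspn \<Rightarrow> 'v \<Rightarrow> 'v multiset" where
  "preset N t = mset_set {q. (q, t) \<in> flow N}"

definition postset :: "('v, 'a) lgspn \<Rightarrow> 'v \<Rightarrow> 'v multiset" where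
  "postset N t = mset_set {q. (t, q) \<in> flow N}"

definition is_marking :: "('v, 'a) lgspn \<Rightarrow> 'v multiset \<Rightarrow> bool" where
  "is_marking N m \<longleftrightarrow> set_mset m \<subseteq> places N"

definition enabled :: "('v, 'a) lgspn \<Rightarrow> 'v multiset \<Rightarrow> 'v \<Rightarrow> bool" where
  "enabled N m t \<longleftrightarrow> t \<in> transitions N \<and> preset N t \<subseteq># m \<and>
     (t \<in> immediate N \<or> \<not> (\<exists>t'\<in>immediate N. preset N t' \<subseteq># m))"

definition fire :: "('v, 'a) lgspn \<Rightarrow> 'v multiset \<Rightarrow> 'v \<Rightarrow> 'v multiset" where
  "fire N m t = (m - preset N t) + postset N t"

definition deadlock :: "('v, 'a) lgspn \<Rightarrow> 'v multiset \<Rightarrow> bool" where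
  "deadlock N m \<longleftrightarrow> \<not> (\<exists>t. enabled N m t)"

definition firing_prob :: "('v, 'a) lgspn \<Rightarrow> 'v multiset \<Rightarrow> 'v \<Rightarrow> real" where
  "firing_prob N m t =
     (if enabled N m t then weight N t / (\<Sum>t' | enabled N m t'. weight N t') else 0)"

section \<open>Labelled stochastic processes\<close>

record ('v, 'a) lsp =
  net :: "('v, 'a) lgspn"
  initial_marking :: "'v multiset"
  final_markings :: "'v multiset set"

definition is_lsp :: "'a set \<Rightarrow> 'a \<Rightarrow> ('v, 'a) lsp \<Rightarrow> bool" where
  "is_lsp Acts tau P \<longleftrightarrow>
     is_lgspn Acts tau (net P) \<and> is_marking (net P) (initial_marking P) \<and>
     finite (final_markings P) \<and>
     (\<forall>m\<in>final_markings P. is_marking (net P) m \<and> deadlock (net P) m)"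

inductive_set reachable :: "('v, 'a) lsp \<Rightarrow> 'v multiset set" for P where
  reachable_init: "initial_marking P \<in> reachable P"
| reachable_step: "m \<in> reachable P \<Longrightarrow> enabled (net P) m t \<Longrightarrow> fire (net P) m t \<in> reachable P"

definition complete_lsp :: "('v, 'a) lsp \<Rightarrow> bool" where
  "complete_lsp P \<longleftrightarrow> final_markings P = {m \<in> reachable P. deadlock (net P) m}"

definition bounded_lsp :: "('v, 'a) lsp \<Rightarrow> bool" where
  "bounded_lsp P \<longleftrightarrow> (\<exists>k. \<forall>m\<in>reachable P. \<forall>q\<in>places (net P). count m q \<le> k)"

definition reachability_graph :: "('v, 'a) lsp \<Rightarrow> ('v multiset, 'v) sts" where
  "reachability_graph P = \<lparr>
     states = reachable P,
     edges = {(m, t, m'). m \<in> reachable P \<and> enabled (net P) m t \<and> m' = fire (net P) m t},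
     edge_prob = (\<lambda>(m, t, m'). firing_prob (net P) m t),
     init = initial_marking P,
     finals = reachable P \<inter> final_markings P\<rparr>"

definition induced_trace ::
    "'a \<Rightarrow> ('v, 'a) lsp \<Rightarrow> ('v multiset \<times> 'v \<times> 'v multiset) list \<Rightarrow> 'a list" where
  "induced_trace tau P es = filter (\<lambda>a. a \<noteq> tau) (map (\<lambda>(m, t, m'). label (net P) t) es)"

definition runs_inducing ::
    "'a \<Rightarrow> ('v, 'a) lsp \<Rightarrow> 'a list \<Rightarrow> ('v multiset \<times> 'v \<times> 'v multiset) list set" where
  "runs_inducing tau P \<sigma> = {es \<in> runs (reachability_graph P). induced_trace tau P es = \<sigma>}"

definition model_traces :: "'a \<Rightarrow> ('v, 'a) lsp \<Rightarrow> 'a list set" where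
  "model_traces tau P = induced_trace tau P ` runs (reachability_graph P)"

definition trace_prob :: "'a \<Rightarrow> ('v, 'a) lsp \<Rightarrow> 'a list \<Rightarrow> real" where
  "trace_prob tau P \<sigma> =
     (\<Sum>\<^sub>\<infinity>es\<in>runs_inducing tau P \<sigma>. path_prob (reachability_graph P) es)"

section \<open>Deterministic finite automata\<close>

record ('l, 's) dfa =
  alphabet :: "'l set"
  dstates :: "'s set"
  dinit :: 's
  dfinals :: "'s set"
  delta :: "'s \<Rightarrow> 'l \<Rightarrow> 's option"

definition is_dfa :: "'l set \<Rightarrow> ('l, 's) dfa \<Rightarrow> bool" where
  "is_dfa L B \<longleftrightarrow>
     alphabet B = L \<and> finite L \<and> finite (dstates B) \<and>
     dinit B \<in> dstates B \<and> dfinals B \<subseteq> dstates B \<and>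
     (\<forall>s l s'. delta B s l = Some s' \<longrightarrow> s \<in> dstates B \<and> l \<in> L \<and> s' \<in> dstates B)"

fun delta_word :: "('l, 's) dfa \<Rightarrow> 's \<Rightarrow> 'l list \<Rightarrow> 's option" where
  "delta_word B s [] = Some s"
| "delta_word B s (l # w) = Option.bind (delta B s l) (\<lambda>s'. delta_word B s' w)"

definition language :: "('l, 's) dfa \<Rightarrow> 'l list set" where
  "language B = {w. \<exists>s\<in>dfinals B. delta_word B (dinit B) w = Some s}"

definition silenced :: "'l \<Rightarrow> ('l, 's) dfa \<Rightarrow> ('l, 's) dfa" where
  "silenced tau B = B\<lparr>
     alphabet := insert tau (alphabet B),
     delta := (\<lambda>s l. if l = tau \<and> s \<in> dstates B then Some s else delta B s l)\<rparr>"

section \<open>Product system\<close>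

inductive_set product_states :: "('v, 'a) lsp \<Rightarrow> ('a, 's) dfa \<Rightarrow> ('v multiset \<times> 's) set"
  for P B where
  product_init: "(init (reachability_graph P), dinit B) \<in> product_states P B"
| product_step:
    "(s1, s2) \<in> product_states P B \<Longrightarrow> (s1, t, s1') \<in> edges (reachability_graph P) \<Longrightarrow>
     delta B s2 (label (net P) t) = Some s2' \<Longrightarrow> (s1', s2') \<in> product_states P B"

text \<open>The finality condition applies to every product state, including the initial one. Otherwise
  a process whose initial marking is already final would lose its empty run in the product.\<close>

definition product_system ::
    "('v, 'a) lsp \<Rightarrow> ('a, 's) dfa \<Rightarrow> ('v multiset \<times> 's, 'v) sts" where
  "product_system P B = \<lparr>
     states = product_states P B,
     edges = {((s1, s2), t, (s1', s2')) | s1 s2 t s1' s2'.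
       (s1, s2) \<in> product_states P B \<and> (s1, t, s1') \<in> edges (reachability_graph P) \<and>
       delta B s2 (label (net P) t) = Some s2'},
     edge_prob = (\<lambda>((s1, s2), t, (s1', s2')). edge_prob (reachability_graph P) (s1, t, s1')),
     init = (init (reachability_graph P), dinit B),
     finals = {(s1, s2) \<in> product_states P B.
       s1 \<in> finals (reachability_graph P) \<and> s2 \<in> dfinals B}\<rparr>"

end

theory Submission
  imports Defs
begin

text \<open>Projecting product edges to the reachability graph and reading the automaton component off
  the labels are mutually inverse, so the runs of the product are in probability-preserving
  bijection with the runs of the process whose trace lies in the language of the DFA. Grouping the
  latter by trace gives the left-hand side. All series converge because final markings are
  deadlocks: no run properly extends another one, hence by induction on the length bound the
  probabilities of finitely many runs add up to at most 1.\<close>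

section \<open>Summability of run probabilities\<close>

lemma reachability_graph_simps [simp]:
  "states (reachability_graph P) = reachable P"
  "(m, t, m') \<in> edges (reachability_graph P) \<longleftrightarrow>
     m \<in> reachable P \<and> enabled (net P) m t \<and> m' = fire (net P) m t"
  "edge_prob (reachability_graph P) (m, t, m') = firing_prob (net P) m t"
  "init (reachability_graph P) = initial_marking P"
  "finals (reachability_graph P) = reachable P \<inter> final_markings P"
  by (auto simp: reachability_graph_def)

lemma is_path_end_in_states: "is_path G s es s' \<Longrightarrow> s' \<in> states G"
  by (induction G s es s' rule: is_path.induct) auto

lemma firing_prob_nonneg:
  assumes "is_lgspn Acts tau N"
  shows "firing_prob N m t \<ge> 0"
proof -
  have "weight N t \<ge> 0" if "enabled N m t" for t
    using assms that by (auto simp: is_lgspn_def enabled_def intro: less_imp_le)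
  then show ?thesis
    by (auto simp: firing_prob_def intro!: divide_nonneg_nonneg sum_nonneg)
qed

text \<open>The sum is a quotient x / x, which is 1, or 0 when x = 0, as happens in a deadlock.
  Hence an inequality.\<close>

lemma sum_firing_prob_le_1: "(\<Sum>t | enabled N m t. firing_prob N m t) \<le> 1"
proof -
  have "(\<Sum>t | enabled N m t. firing_prob N m t) =
      (\<Sum>t | enabled N m t. weight N t) / (\<Sum>t | enabled N m t. weight N t)"
    by (simp add: firing_prob_def flip: sum_divide_distrib)
  also have "\<dots> \<le> 1"
    by simp
  finally show ?thesis .
qed

lemma finite_enabled:
  assumes "is_lgspn Acts tau N"
  shows "finite {t. enabled N m t}"
  by (rule finite_subset[of _ "transitions N"]) (use assms in \<open>auto simp: enabled_def is_lgspn_def\<close>)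

lemma path_prob_nonneg:
  assumes "is_lgspn Acts tau (net P)"
  shows "path_prob (reachability_graph P) es \<ge> 0"
  unfolding path_prob_def
  by (rule prod_list_nonneg) (auto simp: firing_prob_nonneg[OF assms])

text \<open>The start marking is a parameter so that the induction on the length bound can pass to
  successor markings. If \<open>m\<close> is not reachable, the set is empty.\<close>

definition final_paths ::
    "('v, 'a) lsp \<Rightarrow> 'v multiset \<Rightarrow> nat \<Rightarrow> ('v multiset \<times> 'v \<times> 'v multiset) list set" where
  "final_paths P m n = {es. length es \<le> n \<and>
     (\<exists>s\<in>finals (reachability_graph P). is_path (reachability_graph P) m es s)}"

text \<open>Final markings of an LSP are deadlocks, so a path starting in one cannot leave
  it.\<close>

lemma final_paths_final:
  assumes "is_lsp Acts tau P" "m \<in> final_markings P"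
  shows "final_paths P m n \<subseteq> {[]}"
proof
  fix es
  assume es: "es \<in> final_paths P m n"
  have "\<not> enabled (net P) m t" for t
    using assms by (auto simp: is_lsp_def deadlock_def)
  with es show "es \<in> {[]}"
    by (cases es) (auto simp: final_paths_def)
qed

text \<open>The empty path would end in \<open>m\<close>, which is not final, so there is a first
  edge to split off. The inclusion may be strict: an unreachable \<open>m\<close> can have a
  reachable successor.\<close>

lemma final_paths_not_final:
  assumes "m \<notin> final_markings P"
  shows "final_paths P m (Suc n) \<subseteq> (\<Union>t\<in>{t. enabled (net P) m t}.
    (\<lambda>es. (m, t, fire (net P) m t) # es) ` final_paths P (fire (net P) m t) n)"
proof
  fix es
  assume es: "es \<in> final_paths P m (Suc n)"
  then obtain t es' where "es = (m, t, fire (net P) m t) # es'" "enabled (net P) m t"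
      and "es' \<in> final_paths P (fire (net P) m t) n"
    using assms by (cases es) (fastforce simp: final_paths_def)+
  then show "es \<in> (\<Union>t\<in>{t. enabled (net P) m t}.
    (\<lambda>es. (m, t, fire (net P) m t) # es) ` final_paths P (fire (net P) m t) n)"
    by blast
qed

text \<open>First-step analysis: the total is at most a combination of the totals at the successors,
  weighted by firing probabilities that sum to at most 1. Finiteness is carried along because
  splitting and enlarging the sums requires finite index sets.\<close>

lemma sum_final_paths_le_1:
  assumes P: "is_lsp Acts tau P"
  shows "finite (final_paths P m n) \<and>
    (\<Sum>es\<in>final_paths P m n. path_prob (reachability_graph P) es) \<le> 1"
proof (induction n arbitrary: m)
  case 0
  have "final_paths P m 0 \<subseteq> {[]}"
    by (auto simp: final_paths_def)
  then consider "final_paths P m 0 = {}" | "final_paths P m 0 = {[]}"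
    by blast
  then show ?case
    by cases (auto simp: path_prob_def)
next
  case (Suc n)
  let ?G = "reachability_graph P" and ?E = "{t. enabled (net P) m t}"
  let ?f = "fire (net P) m"
  let ?C = "\<lambda>t. (\<lambda>es. (m, t, ?f t) # es) ` final_paths P (?f t) n"
  have N: "is_lgspn Acts tau (net P)"
    using P by (simp add: is_lsp_def)
  show ?case
  proof (cases "m \<in> final_markings P")
    case True
    then consider "final_paths P m (Suc n) = {}" | "final_paths P m (Suc n) = {[]}"
      using final_paths_final[OF P True, of "Suc n"] by blast
    then show ?thesis
      by cases (auto simp: path_prob_def)
  next
    case False
    note sub = final_paths_not_final[OF False, of n]
    have fin: "finite (\<Union>t\<in>?E. ?C t)"
      using Suc finite_enabled[OF N] by auto
    have "(\<Sum>es\<in>final_paths P m (Suc n). path_prob ?G es) \<le> (\<Sum>es\<in>(\<Union>t\<in>?E. ?C t). path_prob ?G es)"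
      by (intro sum_mono2 fin sub path_prob_nonneg[OF N])
    also have "\<dots> = (\<Sum>t\<in>?E. \<Sum>es\<in>?C t. path_prob ?G es)"
      \<comment> \<open>Paths from different classes differ in the transition of their first
        edge.\<close>
      by (rule sum.UNION_disjoint) (use Suc finite_enabled[OF N] in auto)
    also have "\<dots> = (\<Sum>t\<in>?E. firing_prob (net P) m t * (\<Sum>es\<in>final_paths P (?f t) n. path_prob ?G es))"
      by (subst sum.reindex) (auto simp: inj_on_def path_prob_def sum_distrib_left)
    also have "\<dots> \<le> (\<Sum>t\<in>?E. firing_prob (net P) m t * 1)"
      using Suc by (intro sum_mono mult_left_mono firing_prob_nonneg[OF N]) auto
    also have "\<dots> \<le> 1"
      using sum_firing_prob_le_1 by simp
    finally show ?thesis
      using finite_subset[OF sub fin] by blast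
  qed
qed

text \<open>A nonnegative family is summable once its finite partial sums are bounded, and finitely
  many runs share a length bound.\<close>

lemma summable_on_runs:
  assumes "is_lsp Acts tau P"
  shows "path_prob (reachability_graph P) summable_on runs (reachability_graph P)"
proof (rule nonneg_bounded_partial_sums_imp_summable_on[where C = 1])
  have N: "is_lgspn Acts tau (net P)"
    using assms by (simp add: is_lsp_def)
  show "path_prob (reachability_graph P) es \<ge> 0" for es
    by (rule path_prob_nonneg[OF N])
  show "\<forall>\<^sub>F F in finite_subsets_at_top (runs (reachability_graph P)).
      sum (path_prob (reachability_graph P)) F \<le> 1"
  proof (rule eventually_finite_subsets_at_top_weakI)
    fix F
    assume F: "finite F" "F \<subseteq> runs (reachability_graph P)"
    \<comment> \<open>The inserted 0 keeps \<open>Max\<close> meaningful when \<open>F\<close> is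
      empty.\<close>
    define n where "n = Max (insert 0 (length ` F))"
    have "length es \<le> n" if "es \<in> F" for es
      using that F by (auto simp: n_def intro!: Max_ge)
    with F have "F \<subseteq> final_paths P (initial_marking P) n"
      by (auto simp: final_paths_def runs_def)
    then have "sum (path_prob (reachability_graph P)) F \<le>
        sum (path_prob (reachability_graph P)) (final_paths P (initial_marking P) n)"
      using sum_final_paths_le_1[OF assms] by (intro sum_mono2 path_prob_nonneg[OF N]) auto
    also have "\<dots> \<le> 1"
      using sum_final_paths_le_1[OF assms] by blast
    finally show "sum (path_prob (reachability_graph P)) F \<le> 1" .
  qed
qed

section \<open>Runs of the product system\<close>

lemma product_system_simps [simp]:
  "states (product_system P B) = product_states P B"
  "((m, q), t, (m', q')) \<in> edges (product_system P B) \<longleftrightarrow> (m, q) \<in> product_states P B \<and>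
     (m, t, m') \<in> edges (reachability_graph P) \<and> delta B q (label (net P) t) = Some q'"
  "edge_prob (product_system P B) ((m, q), t, (m', q')) =
     edge_prob (reachability_graph P) (m, t, m')"
  "init (product_system P B) = (init (reachability_graph P), dinit B)"
  "(m, q) \<in> finals (product_system P B) \<longleftrightarrow> (m, q) \<in> product_states P B \<and>
     m \<in> finals (reachability_graph P) \<and> q \<in> dfinals B"
  by (auto simp: product_system_def)

lemma product_states_reachable: "(m, q) \<in> product_states P B \<Longrightarrow> m \<in> reachable P"
  by (induction rule: product_states.induct) (auto intro: reachable.intros)

definition project_edge :: "('m \<times> 's) \<times> 't \<times> ('m \<times> 's) \<Rightarrow> 'm \<times> 't \<times> 'm" where
  "project_edge = (\<lambda>((m, q), t, (m', q')). (m, t, m'))"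

lemma project_edge_simp [simp]: "project_edge ((m, q), t, (m', q')) = (m, t, m')"
  by (simp add: project_edge_def)

text \<open>Candidate inverse of the projection: determinism forces every automaton component. The
  value of \<open>the\<close> is meaningful only while \<open>delta\<close> is defined along the
  labels, which the lemmas ensure through \<open>delta_word\<close>.\<close>

fun lift_path :: "('v, 'a) lsp \<Rightarrow> ('a, 's) dfa \<Rightarrow> 's \<Rightarrow> ('m \<times> 'v \<times> 'm) list \<Rightarrow>
    (('m \<times> 's) \<times> 'v \<times> ('m \<times> 's)) list" where
  "lift_path P B q [] = []"
| "lift_path P B q ((m, t, m') # es) = (let q' = the (delta B q (label (net P) t))
     in ((m, q), t, (m', q')) # lift_path P B q' es)"

text \<open>Unlike in \<open>induced_trace\<close>, silent labels are kept, since the silenced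
  automaton reads them.\<close>

definition path_labels :: "('v, 'a) lsp \<Rightarrow> ('m \<times> 'v \<times> 'm) list \<Rightarrow> 'a list" where
  "path_labels P es = map (\<lambda>(m, t, m'). label (net P) t) es"

lemma path_labels_simps [simp]:
  "path_labels P [] = []"
  "path_labels P ((m, t, m') # es) = label (net P) t # path_labels P es"
  by (simp_all add: path_labels_def)

lemma path_prob_product_system:
  "path_prob (product_system P B) \<eta> = path_prob (reachability_graph P) (map project_edge \<eta>)"
proof -
  have "edge_prob (product_system P B) e = edge_prob (reachability_graph P) (project_edge e)" for e
    by (cases e) auto
  then show ?thesis
    by (simp add: path_prob_def comp_def)
qed

lemma project_product_path:
  assumes "is_path (product_system P B) (m, q) \<eta> (m', q')"
  shows "is_path (reachability_graph P) m (map project_edge \<eta>) m'"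
    and "delta_word B q (path_labels P (map project_edge \<eta>)) = Some q'"
    and "lift_path P B q (map project_edge \<eta>) = \<eta>"
  using assms
  by (induction \<eta> arbitrary: m q) (auto dest: product_states_reachable)

lemma lift_path_product:
  assumes "is_path (reachability_graph P) m es m'" "(m, q) \<in> product_states P B"
    and "delta_word B q (path_labels P es) = Some q'"
  shows "is_path (product_system P B) (m, q) (lift_path P B q es) (m', q')"
    and "map project_edge (lift_path P B q es) = es"
proof -
  have "is_path (product_system P B) (m, q) (lift_path P B q es) (m', q') \<and>
      map project_edge (lift_path P B q es) = es"
    using assms
  proof (induction es arbitrary: m q)
    case Nil
    then show ?case by simp
  next
    case (Cons e es)
    obtain t v where e: "e = (m, t, v)" "(m, t, v) \<in> edges (reachability_graph P)"
        "is_path (reachability_graph P) v es m'"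
      using Cons.prems(1) by (cases e) auto
    obtain r where r: "delta B q (label (net P) t) = Some r"
        "delta_word B r (path_labels P es) = Some q'"
      using Cons.prems(3) e by (auto split: bind_splits)
    \<comment> \<open>The induction hypothesis needs the successor pair to be a product state
      again.\<close>
    have "(v, r) \<in> product_states P B"
      using product_step[OF Cons.prems(2) e(2) r(1)] .
    then show ?case
      using Cons.IH[OF e(3) _ r(2)] Cons.prems(2) e r(1) by simp
  qed
  then show "is_path (product_system P B) (m, q) (lift_path P B q es) (m', q')"
    and "map project_edge (lift_path P B q es) = es"
    by auto
qed

text \<open>This holds for an arbitrary automaton \<open>B\<close> reading all labels; the treatment
  of silent steps is kept separate.\<close>

lemma bij_betw_project_runs:
  "bij_betw (map project_edge) (runs (product_system P B))
     {es \<in> runs (reachability_graph P). path_labels P es \<in> language B}"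
proof (rule bij_betw_byWitness[where f' = "lift_path P B (dinit B)"])
  show "\<forall>\<eta>\<in>runs (product_system P B). lift_path P B (dinit B) (map project_edge \<eta>) = \<eta>"
    by (auto simp: runs_def project_product_path(3))
  show "map project_edge ` runs (product_system P B) \<subseteq>
      {es \<in> runs (reachability_graph P). path_labels P es \<in> language B}"
    by (fastforce simp: runs_def language_def dest: project_product_path(1,2))
  have init: "(initial_marking P, dinit B) \<in> product_states P B"
    using product_init[of P B] by simp
  show "\<forall>es\<in>{es \<in> runs (reachability_graph P). path_labels P es \<in> language B}.
      map project_edge (lift_path P B (dinit B) es) = es"
    using lift_path_product(2)[OF _ init] by (auto simp: runs_def language_def)
  show "lift_path P B (dinit B) ` {es \<in> runs (reachability_graph P). path_labels P es \<in> language B}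
      \<subseteq> runs (product_system P B)"
  proof (rule image_subsetI)
    fix es
    assume "es \<in> {es \<in> runs (reachability_graph P). path_labels P es \<in> language B}"
    then obtain m q where "m \<in> finals (reachability_graph P)" "q \<in> dfinals B"
        and "is_path (reachability_graph P) (initial_marking P) es m"
        and "delta_word B (dinit B) (path_labels P es) = Some q"
      by (auto simp: runs_def language_def)
    moreover from this have
      "is_path (product_system P B) (initial_marking P, dinit B) (lift_path P B (dinit B) es) (m, q)"
      using lift_path_product(1)[OF _ init] by blast
    \<comment> \<open>Finality in the product includes being a product state, which every endpoint
      of a path is.\<close>
    moreover from this have "(m, q) \<in> product_states P B"
      using is_path_end_in_states by fastforce
    ultimately show "lift_path P B (dinit B) es \<in> runs (product_system P B)"
      unfolding runs_def by (auto intro!: bexI[of _ "(m, q)"])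
  qed
qed

section \<open>The silenced automaton\<close>

text \<open>Reading \<open>tau\<close> follows a self-loop and leaves the state unchanged, so it can
  be deleted from the word. The loops exist only on \<open>dstates A\<close>, a set that the
  transitions of \<open>A\<close> do not leave.\<close>

lemma delta_word_silenced:
  assumes "is_dfa L A" "q \<in> dstates A"
  shows "delta_word (silenced tau A) q w = delta_word A q (filter (\<lambda>a. a \<noteq> tau) w)"
  using assms(2)
proof (induction w arbitrary: q)
  case Nil
  then show ?case by simp
next
  case (Cons a w)
  have "r \<in> dstates A" if "delta A q a = Some r" for r
    using assms(1) that by (auto simp: is_dfa_def)
  with Cons show ?case
    by (cases "delta A q a") (auto simp: silenced_def)
qed

lemma path_labels_in_language_silenced:
  assumes "is_dfa L A"
  shows "path_labels P es \<in> language (silenced tau A) \<longleftrightarrow> induced_trace tau P es \<in> language A"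
proof -
  have "dinit A \<in> dstates A"
    using assms by (simp add: is_dfa_def)
  moreover have "dinit (silenced tau A) = dinit A" "dfinals (silenced tau A) = dfinals A"
    by (simp_all add: silenced_def)
  ultimately show ?thesis
    by (simp add: language_def delta_word_silenced[OF assms] induced_trace_def path_labels_def)
qed

text \<open>Since \<open>infsum\<close> defaults to 0 on families that are not summable, the
  summability claims are what gives the equation its intended meaning.\<close>

theorem theorem4:
  fixes Acts :: "'a set" and tau :: 'a
    and P :: "('v, 'a) lsp" and A :: "('a, 's) dfa"
  assumes "finite Acts" and "tau \<notin> Acts"
    and "is_lsp Acts tau P" and "bounded_lsp P" and "complete_lsp P"
    and "is_dfa Acts A"
  shows "(\<forall>\<sigma>\<in>model_traces tau P.
            path_prob (reachability_graph P) summable_on runs_inducing tau P \<sigma>) \<and>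
         trace_prob tau P summable_on (model_traces tau P \<inter> language A) \<and>
         path_prob (product_system P (silenced tau A)) summable_on
            runs (product_system P (silenced tau A)) \<and>
         (\<Sum>\<^sub>\<infinity>\<sigma>\<in>model_traces tau P \<inter> language A. trace_prob tau P \<sigma>) =
         (\<Sum>\<^sub>\<infinity>\<eta>\<in>runs (product_system P (silenced tau A)).
            path_prob (product_system P (silenced tau A)) \<eta>)"
proof -
  let ?G = "reachability_graph P" and ?U = "product_system P (silenced tau A)"
  let ?T = "model_traces tau P \<inter> language A"
  let ?S = "SIGMA \<sigma>:?T. runs_inducing tau P \<sigma>"
  define R where "R = {es \<in> runs ?G. induced_trace tau P es \<in> language A}"
  note summable = summable_on_runs[OF assms(3)]
  have sum_R: "path_prob ?G summable_on R"
    by (rule summable_on_subset_banach[OF summable]) (auto simp: R_def)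
  have bij_U: "bij_betw (map project_edge) (runs ?U) R"
    using bij_betw_project_runs[of P "silenced tau A"]
    by (simp add: path_labels_in_language_silenced[OF assms(6)] R_def)
  \<comment> \<open>Every run induces exactly one trace, so tagging runs with their traces neither
    loses nor duplicates any.\<close>
  have bij_S: "bij_betw snd ?S R"
    by (rule bij_betw_byWitness[where f' = "\<lambda>es. (induced_trace tau P es, es)"])
      (auto simp: R_def runs_inducing_def model_traces_def)
  have sum_S: "(\<lambda>(\<sigma>, es). path_prob ?G es) summable_on ?S"
    using summable_on_reindex_bij_betw[OF bij_S, of "path_prob ?G"] sum_R
    by (simp add: case_prod_unfold)
  have "path_prob ?G summable_on runs_inducing tau P \<sigma>" for \<sigma>
    by (rule summable_on_subset_banach[OF summable]) (auto simp: runs_inducing_def)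
  moreover have "trace_prob tau P summable_on ?T"
    unfolding trace_prob_def using summable_on_Sigma_banach[OF sum_S] by simp
  moreover have "path_prob ?U summable_on runs ?U"
    using summable_on_reindex_bij_betw[OF bij_U, of "path_prob ?G"] sum_R
    by (simp add: path_prob_product_system[abs_def])
  moreover have "(\<Sum>\<^sub>\<infinity>\<sigma>\<in>?T. trace_prob tau P \<sigma>) = (\<Sum>\<^sub>\<infinity>\<eta>\<in>runs ?U. path_prob ?U \<eta>)"
  proof -
    \<comment> \<open>Fubini for infinite sums: summability over the tagged runs allows the iterated
      sum to be flattened.\<close>
    have "(\<Sum>\<^sub>\<infinity>\<sigma>\<in>?T. trace_prob tau P \<sigma>) = (\<Sum>\<^sub>\<infinity>(\<sigma>, es)\<in>?S. path_prob ?G es)"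
      unfolding trace_prob_def by (rule infsum_Sigma'_banach[OF sum_S])
    also have "\<dots> = infsum (path_prob ?G) R"
      using infsum_reindex_bij_betw[OF bij_S, of "path_prob ?G"] by (simp add: case_prod_unfold)
    also have "\<dots> = (\<Sum>\<^sub>\<infinity>\<eta>\<in>runs ?U. path_prob ?U \<eta>)"
      using infsum_reindex_bij_betw[OF bij_U, of "path_prob ?G"]
      by (simp add: path_prob_product_system)
    finally show ?thesis .
  qed
  ultimately show ?thesis
    by blast
qed

end
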